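(* Let $M$ be a differentiable manifold of dimension $m$, let $p\in M$, let $V$ be a linear subspace of $T_pM$, let $L\in\mathcal{L}(V,\mathbb{R})$ and let $f\colon M\to\mathbb{R}$. Then the property that $L\circ D\varphi^{-1}(\varphi(p))\in\mathcal{L}(D\varphi(p)[V],\mathbb{R})$ is a tangential derivative of $f\circ\varphi^{-1}\colon\varphi(U)\to\mathbb{R}$ at $\varphi(p)$ with respect to $D\varphi(p)[V]$ does not depend on the local chart $\varphi\colon U\subseteq M\to\mathbb{R}^m$ with $p\in U$: if it holds for some such local chart, then it holds for every such local chart.
   Context: A local chart of a differentiable manifold $M$ of dimension $m$ is a map $\varphi\colon U\subseteq M\to\mathbb{R}^m$ such that $U$ is an open subset of $M$ and $\varphi\colon U\to\varphi(U)$ is a diffeomorphism (onto an open subset of $\mathbb{R}^m$). $T_pM$ is the tangent space at $p$, and $\mathcal{L}(V,\mathbb{R})$ is the space of linear maps from $V$ to $\mathbb{R}$. Tangential derivative in Euclidean space: let $A\subseteq\mathbb{R}^m$, $a\in A$, $h\colon A\to\mathbb{R}^n$, and let $W\subseteq\mathbb{R}^m$ be a linear subspace. A linear map $\Lambda\in\mathcal{L}(W,\mathbb{R}^n)$ is a tangential derivative of $h$ at $a$ with respect to $W$ if for every $\varepsilon>0$ there exist $\delta>0$ and $\theta>0$ such that if $x\in A$, $w\in W$, $\lVert x-a\rVert\le\delta$ and $\lVert x-a-w\rVert\le\theta\lVert x-a\rVert$, then $\lVert h(x)-h(a)-\Lambda[w]\rVert\le\varepsilon\lVert x-a\rVert$.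 *)

theory Defs
  imports "HOL-Analysis.Analysis" "HOL-Library.Extended_Nat"
begin

section \<open>Maps of class C^k on open subsets of Euclidean space\<close>

text \<open>Only meant for open \<open>S\<close>: the derivatives are full Frechet derivatives, and the one of
  order \<open>Suc n\<close> is required to exist and to be continuous in every fixed direction, which in finite
  dimension is continuity of the derivative.\<close>

primrec Cn_on :: "nat \<Rightarrow> 'a::real_normed_vector set \<Rightarrow> ('a \<Rightarrow> 'b::real_normed_vector) \<Rightarrow> bool" where
  "Cn_on 0 S f \<longleftrightarrow> continuous_on S f"
| "Cn_on (Suc n) S f \<longleftrightarrow> (\<forall>x\<in>S. f differentiable (at x)) \<and>
     (\<forall>v. Cn_on n S (\<lambda>x. frechet_derivative f (at x) v))"

definition Ck_on :: "enat \<Rightarrow> 'a::real_normed_vector set \<Rightarrow> ('a \<Rightarrow> 'b::real_normed_vector) \<Rightarrow> bool" where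
  "Ck_on k S f \<longleftrightarrow> (\<forall>n. enat n \<le> k \<longrightarrow> Cn_on n S f)"


section \<open>Differentiable manifolds and local charts\<close>

text \<open>The points of a manifold are the points of its topology. A chart is a pair \<open>(U, \<phi>)\<close>; the values
  of \<open>\<phi>\<close> outside \<open>U\<close> are irrelevant, and its inverse is \<open>inv_into U \<phi>\<close> on \<open>\<phi> ` U\<close>.
  The dimension is \<open>CARD('m)\<close>.\<close>

record ('a, 'm) manifold =
  mtop :: "'a topology"
  atlas :: "('a set \<times> ('a \<Rightarrow> real ^ 'm)) set"

definition differentiable_manifold :: "enat \<Rightarrow> ('a, 'm::finite) manifold \<Rightarrow> bool" where
  "differentiable_manifold k M \<longleftrightarrow>
     1 \<le> k \<and> Hausdorff_space (mtop M) \<and> second_countable (mtop M) \<and>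
     (\<Union>(U, \<phi>)\<in>atlas M. U) = topspace (mtop M) \<and>
     (\<forall>(U, \<phi>)\<in>atlas M. openin (mtop M) U \<and> open (\<phi> ` U) \<and>
        homeomorphic_map (subtopology (mtop M) U) (top_of_set (\<phi> ` U)) \<phi>) \<and>
     (\<forall>(U, \<phi>)\<in>atlas M. \<forall>(U', \<psi>)\<in>atlas M. Ck_on k (\<phi> ` (U \<inter> U')) (\<psi> \<circ> inv_into U \<phi>))"

definition Ck_from_manifold ::
  "enat \<Rightarrow> ('a, 'm::finite) manifold \<Rightarrow> 'a set \<Rightarrow> ('a \<Rightarrow> 'b::real_normed_vector) \<Rightarrow> bool" where
  "Ck_from_manifold k M U h \<longleftrightarrow>
     (\<forall>(V, \<psi>)\<in>atlas M. Ck_on k (\<psi> ` (U \<inter> V)) (h \<circ> inv_into V \<psi>))"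

definition Ck_into_manifold ::
  "enat \<Rightarrow> ('a, 'm::finite) manifold \<Rightarrow> 'b::real_normed_vector set \<Rightarrow> ('b \<Rightarrow> 'a) \<Rightarrow> bool" where
  "Ck_into_manifold k M S g \<longleftrightarrow> continuous_map (top_of_set S) (mtop M) g \<and>
     (\<forall>(V, \<psi>)\<in>atlas M. Ck_on k (S \<inter> g -` V) (\<psi> \<circ> g))"

text \<open>Local charts are not required to belong to the given atlas.\<close>

definition local_chart ::
  "enat \<Rightarrow> ('a, 'm::finite) manifold \<Rightarrow> 'a set \<Rightarrow> ('a \<Rightarrow> real ^ 'm) \<Rightarrow> bool" where
  "local_chart k M U \<phi> \<longleftrightarrow> openin (mtop M) U \<and> open (\<phi> ` U) \<and> inj_on \<phi> U \<and>
     Ck_from_manifold k M U \<phi> \<and> Ck_into_manifold k M (\<phi> ` U) (inv_into U \<phi>)"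


section \<open>Tangent spaces and differentials\<close>

text \<open>Tangent vectors are equivalence classes of curves. Only the germ of a curve at \<open>0\<close> matters, so
  curves are total functions whose values are unconstrained away from \<open>0\<close>.\<close>

type_synonym 'a tangent_vector = "(real \<Rightarrow> 'a) set"

definition curves_at :: "('a, 'm::finite) manifold \<Rightarrow> 'a \<Rightarrow> (real \<Rightarrow> 'a) set" where
  "curves_at M p = {\<gamma>. \<gamma> 0 = p \<and> limitin (mtop M) \<gamma> p (at 0) \<and>
     (\<forall>(U, \<phi>)\<in>atlas M. p \<in> U \<longrightarrow> (\<phi> \<circ> \<gamma>) differentiable (at 0))}"

definition tangent_class :: "('a, 'm::finite) manifold \<Rightarrow> 'a \<Rightarrow> (real \<Rightarrow> 'a) \<Rightarrow> 'a tangent_vector" where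
  "tangent_class M p \<gamma> = {\<sigma> \<in> curves_at M p. \<forall>(U, \<phi>)\<in>atlas M. p \<in> U \<longrightarrow>
     vector_derivative (\<phi> \<circ> \<sigma>) (at 0) = vector_derivative (\<phi> \<circ> \<gamma>) (at 0)}"

definition tangent_space :: "('a, 'm::finite) manifold \<Rightarrow> 'a \<Rightarrow> 'a tangent_vector set" where
  "tangent_space M p = tangent_class M p ` curves_at M p"

text \<open>The differential \<open>Dh(p)[\<xi>]\<close> of a map \<open>h\<close> from a neighbourhood of \<open>p\<close> to a normed space (the point
  \<open>p\<close> is determined by \<open>\<xi>\<close>), and the differential \<open>Dg(a)[w]\<close> of a map \<open>g\<close> from a neighbourhood of \<open>a\<close> in
  a normed space into the manifold.\<close>

definition differential :: "('a \<Rightarrow> 'b::real_normed_vector) \<Rightarrow> 'a tangent_vector \<Rightarrow> 'b" where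
  "differential h \<xi> = (THE w. \<forall>\<gamma>\<in>\<xi>. ((h \<circ> \<gamma>) has_vector_derivative w) (at 0))"

definition differential_into ::
  "('a, 'm::finite) manifold \<Rightarrow> ('b::real_normed_vector \<Rightarrow> 'a) \<Rightarrow> 'b \<Rightarrow> 'b \<Rightarrow> 'a tangent_vector" where
  "differential_into M g a w = tangent_class M (g a) (\<lambda>t. g (a + t *\<^sub>R w))"

text \<open>The vector space structure of the tangent space is the one making the differentials of
  all charts of the atlas linear.\<close>

definition tangent_zero :: "('a, 'm::finite) manifold \<Rightarrow> 'a \<Rightarrow> 'a tangent_vector" where
  "tangent_zero M p = tangent_class M p (\<lambda>_. p)"

definition tangent_add ::
  "('a, 'm::finite) manifold \<Rightarrow> 'a \<Rightarrow> 'a tangent_vector \<Rightarrow> 'a tangent_vector \<Rightarrow> 'a tangent_vector" where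
  "tangent_add M p \<xi> \<eta> = (THE \<zeta>. \<zeta> \<in> tangent_space M p \<and>
     (\<forall>(U, \<phi>)\<in>atlas M. p \<in> U \<longrightarrow> differential \<phi> \<zeta> = differential \<phi> \<xi> + differential \<phi> \<eta>))"

definition tangent_scale ::
  "('a, 'm::finite) manifold \<Rightarrow> 'a \<Rightarrow> real \<Rightarrow> 'a tangent_vector \<Rightarrow> 'a tangent_vector" where
  "tangent_scale M p c \<xi> = (THE \<zeta>. \<zeta> \<in> tangent_space M p \<and>
     (\<forall>(U, \<phi>)\<in>atlas M. p \<in> U \<longrightarrow> differential \<phi> \<zeta> = c *\<^sub>R differential \<phi> \<xi>))"

definition tangent_subspace :: "('a, 'm::finite) manifold \<Rightarrow> 'a \<Rightarrow> 'a tangent_vector set \<Rightarrow> bool" where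
  "tangent_subspace M p V \<longleftrightarrow> V \<subseteq> tangent_space M p \<and> tangent_zero M p \<in> V \<and>
     (\<forall>\<xi>\<in>V. \<forall>\<eta>\<in>V. tangent_add M p \<xi> \<eta> \<in> V) \<and> (\<forall>c. \<forall>\<xi>\<in>V. tangent_scale M p c \<xi> \<in> V)"

definition tangent_functional ::
  "('a, 'm::finite) manifold \<Rightarrow> 'a \<Rightarrow> 'a tangent_vector set \<Rightarrow> ('a tangent_vector \<Rightarrow> real) \<Rightarrow> bool" where
  "tangent_functional M p V L \<longleftrightarrow>
     (\<forall>\<xi>\<in>V. \<forall>\<eta>\<in>V. L (tangent_add M p \<xi> \<eta>) = L \<xi> + L \<eta>) \<and>
     (\<forall>c. \<forall>\<xi>\<in>V. L (tangent_scale M p c \<xi>) = c * L \<xi>)"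


section \<open>Tangential derivatives in Euclidean space\<close>

definition linear_map_on ::
  "'a::real_vector set \<Rightarrow> ('a \<Rightarrow> 'b::real_vector) \<Rightarrow> bool" where
  "linear_map_on W \<Lambda> \<longleftrightarrow> (\<forall>v\<in>W. \<forall>w\<in>W. \<Lambda> (v + w) = \<Lambda> v + \<Lambda> w) \<and>
     (\<forall>c. \<forall>w\<in>W. \<Lambda> (c *\<^sub>R w) = c *\<^sub>R \<Lambda> w)"

definition tangential_derivative ::
  "('a::euclidean_space \<Rightarrow> 'b::euclidean_space) \<Rightarrow> 'a set \<Rightarrow> 'a \<Rightarrow> 'a set \<Rightarrow> ('a \<Rightarrow> 'b) \<Rightarrow> bool" where
  "tangential_derivative h A a W \<Lambda> \<longleftrightarrow> a \<in> A \<and> subspace W \<and> linear_map_on W \<Lambda> \<and>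
     (\<forall>\<epsilon>>0. \<exists>\<delta>>0. \<exists>\<theta>>0. \<forall>x\<in>A. \<forall>w\<in>W.
        norm (x - a) \<le> \<delta> \<longrightarrow> norm (x - a - w) \<le> \<theta> * norm (x - a) \<longrightarrow>
        norm (h x - h a - \<Lambda> w) \<le> \<epsilon> * norm (x - a))"

end

theory Submission
  imports Defs
begin

text \<open>Only differentiability at the point matters. For a chart \<open>\<phi>\<close> at \<open>p\<close> and an atlas chart \<open>\<kappa>\<close> at
  \<open>p\<close>, the two transition maps have mutually inverse derivatives at the image points, so \<open>D\<phi>(p)\<close> is
  a bijection from the tangent space with inverse \<open>D\<phi>\<^sup>-\<^sup>1(\<phi> p)\<close>. Passing through \<open>\<kappa>\<close>, two charts \<open>\<phi>\<close>
  and \<open>\<psi>\<close> are related by a map that is differentiable at the point with invertible derivative and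
  that intertwines the two linear functionals. Such a map distorts distances to the base point and
  to the subspace only by bounded factors, up to an error \<open>o(\<parallel>y - b\<parallel>)\<close> which is absorbed by \<open>\<theta>\<close>.\<close>

section \<open>Change of coordinates in Euclidean space\<close>

text \<open>A test pair \<open>(y, B w0)\<close> for \<open>h'\<close> at \<open>b\<close> becomes
  the test pair \<open>(\<sigma> y, w0)\<close> for \<open>h\<close> at \<open>a\<close>: since
  \<open>C\<close> is invertible, \<open>norm (y - b)\<close> and
  \<open>norm (\<sigma> y - a)\<close> are comparable near \<open>b\<close>, and \<open>C\<close>
  carries \<open>B w0\<close> back to \<open>w0\<close>. The map \<open>\<sigma>\<close> runs from
  the new coordinates to the old ones, while \<open>B\<close>, the inverse of its derivative,
  transports the subspace forward.\<close>

lemma tangential_derivative_change_of_coordinates: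
  fixes \<sigma> :: "'b::euclidean_space \<Rightarrow> 'a::euclidean_space" and h :: "'a \<Rightarrow> 'c::euclidean_space"
  assumes td: "tangential_derivative h A a W \<Lambda>"
    and b: "b \<in> A'" "\<sigma> b = a"
    and ev: "\<forall>\<^sub>F y in nhds b. y \<in> A' \<longrightarrow> \<sigma> y \<in> A \<and> h' y = h (\<sigma> y)"
    and der: "(\<sigma> has_derivative C) (at b)"
    and B: "linear B" "\<And>y. B (C y) = y" "\<And>x. C (B x) = x"
    and \<Lambda>: "\<And>w. w \<in> W \<Longrightarrow> \<Lambda>' (B w) = \<Lambda> w"
  shows "tangential_derivative h' A' b (B ` W) \<Lambda>'"
proof -
  have W: "subspace W" and lin: "linear_map_on W \<Lambda>"
    using td by (auto simp: tangential_derivative_def)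
  have est: "\<exists>\<delta>>0. \<exists>\<theta>>0. \<forall>y\<in>A'. \<forall>w\<in>B ` W.
      norm (y - b) \<le> \<delta> \<longrightarrow> norm (y - b - w) \<le> \<theta> * norm (y - b) \<longrightarrow>
      norm (h' y - h' b - \<Lambda>' w) \<le> \<epsilon> * norm (y - b)" if "\<epsilon> > 0" for \<epsilon> :: real
  proof -
    have linC: "linear C"
      using der has_derivative_linear by blast
    obtain KB where KB: "KB > 0" "\<And>x. norm (B x) \<le> KB * norm x"
      using linear_bounded_pos[OF B(1)] by blast
    obtain KC where KC: "KC > 0" "\<And>x. norm (C x) \<le> KC * norm x"
      using linear_bounded_pos[OF linC] by blast
    \<comment> \<open>One bound for both \<open>B\<close> and \<open>C\<close>. Being at least
      \<open>1\<close>, it also satisfies \<open>1 / (2 * K) \<le> K\<close>, which the upper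
      estimate of \<open>norm (\<sigma> y - a)\<close> uses.\<close>
    define K where "K = max 1 (max KB KC)"
    have K1: "K \<ge> 1" "KB \<le> K" "KC \<le> K"
      by (auto simp: K_def)
    have K: "K \<ge> 1" "\<And>x. norm (B x) \<le> K * norm x" "\<And>x. norm (C x) \<le> K * norm x"
      using K1 order_trans[OF KB(2) mult_right_mono[OF K1(2)]]
        order_trans[OF KC(2) mult_right_mono[OF K1(3)]] by auto
    \<comment> \<open>Passing from \<open>norm (\<sigma> y - a)\<close> back to
      \<open>norm (y - b)\<close> at the end costs a factor \<open>2 * K\<close>.\<close>
    have \<epsilon>: "\<epsilon> / (2 * K) > 0"
      using that K by simp
    have "\<forall>\<epsilon>>0. \<exists>\<delta>>0. \<exists>\<theta>>0. \<forall>x\<in>A. \<forall>w\<in>W.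
        norm (x - a) \<le> \<delta> \<longrightarrow> norm (x - a - w) \<le> \<theta> * norm (x - a) \<longrightarrow>
        norm (h x - h a - \<Lambda> w) \<le> \<epsilon> * norm (x - a)"
      using td unfolding tangential_derivative_def by (elim conjE)
    from this[rule_format, OF \<epsilon>] obtain \<delta> \<theta> where \<delta>: "\<delta> > 0" and \<theta>: "\<theta> > 0" and
      old: "\<And>x w. x \<in> A \<Longrightarrow> w \<in> W \<Longrightarrow> norm (x - a) \<le> \<delta> \<Longrightarrow>
        norm (x - a - w) \<le> \<theta> * norm (x - a) \<Longrightarrow>
        norm (h x - h a - \<Lambda> w) \<le> \<epsilon> / (2 * K) * norm (x - a)"
      by blast
    \<comment> \<open>Tolerance for the linearization error of \<open>\<sigma>\<close>. The first
      entry gives \<open>K * \<eta> \<le> 1 / 2\<close>, so that the error can be absorbed in the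
      lower bound for \<open>norm (\<sigma> y - a)\<close>; the second spends half of the budget
      \<open>\<theta> / (2 * K)\<close>.\<close>
    define \<eta> where "\<eta> = min (1 / (2 * K)) (\<theta> / (4 * K))"
    have \<eta>: "\<eta> > 0" "\<eta> \<le> 1 / (2 * K)" "\<eta> \<le> \<theta> / (4 * K)"
      using K \<theta> by (auto simp: \<eta>_def)
    obtain d1 where d1: "d1 > 0" "\<And>y. norm (y - b) < d1 \<Longrightarrow>
        norm (\<sigma> y - a - C (y - b)) \<le> \<eta> * norm (y - b)"
      using der \<eta>(1) b(2) unfolding has_derivative_at_alt by blast
    obtain d2 where d2: "d2 > 0" "\<And>y. dist y b < d2 \<Longrightarrow> y \<in> A' \<Longrightarrow> \<sigma> y \<in> A \<and> h' y = h (\<sigma> y)"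
      using ev unfolding eventually_nhds_metric by auto
    \<comment> \<open>The filter \<open>nhds b\<close> includes the point \<open>b\<close> itself,
      so the base values can be compared too.\<close>
    have hb: "h' b = h a"
      using d2(2)[of b] d2(1) b by auto
    \<comment> \<open>The first entry ensures \<open>norm (\<sigma> y - a) \<le> \<delta>\<close>;
      halving \<open>d1\<close> and \<open>d2\<close> yields the strict inequalities.\<close>
    define \<delta>' where "\<delta>' = min (\<delta> / (2 * K)) (min (d1 / 2) (d2 / 2))"
    \<comment> \<open>Chosen so that \<open>K * \<theta>'\<close> is
      \<open>\<theta> / (4 * K)\<close>, the other half of the budget.\<close>
    define \<theta>' where "\<theta>' = \<theta> / (4 * K * K)"
    have pos: "\<delta>' > 0" "\<theta>' > 0"
      using K \<delta> \<theta> d1 d2 by (auto simp: \<delta>'_def \<theta>'_def)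
    have "norm (h' y - h' b - \<Lambda>' w) \<le> \<epsilon> * norm (y - b)"
      if y: "y \<in> A'" "norm (y - b) \<le> \<delta>'" and w: "w \<in> B ` W"
        and yw: "norm (y - b - w) \<le> \<theta>' * norm (y - b)" for y w
    proof -
      obtain w0 where w0: "w0 \<in> W" "w = B w0"
        using w by blast
      have sm: "norm (y - b) \<le> \<delta> / (2 * K)" "norm (y - b) < d1" "dist y b < d2"
        using y(2) d1(1) d2(1) by (auto simp: \<delta>'_def dist_norm)
      note e1 = d1(2)[OF sm(2)]
      have x: "\<sigma> y \<in> A" "h' y = h (\<sigma> y)"
        using d2(2)[OF sm(3) y(1)] by auto
      have "norm (\<sigma> y - a) \<le> norm (\<sigma> y - a - C (y - b)) + norm (C (y - b))"
        by (metis diff_add_cancel norm_triangle_ineq)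
      also have "\<dots> \<le> \<eta> * norm (y - b) + K * norm (y - b)"
        using e1 K(3) by (intro add_mono) auto
      also have "\<dots> \<le> K * norm (y - b) + K * norm (y - b)"
      proof -
        have "1 / (2 * K) \<le> K"
          using K(1) by (simp add: divide_le_eq) (smt (verit) mult_le_cancel_left1)
        then show ?thesis
          using \<eta>(2) by (intro add_mono mult_right_mono) auto
      qed
      finally have up: "norm (\<sigma> y - a) \<le> 2 * K * norm (y - b)"
        by (simp add: algebra_simps)
      \<comment> \<open>Since \<open>y - b = B (C (y - b))\<close>, the bound on \<open>B\<close>
        controls \<open>norm (y - b)\<close> from above; the half of it that appears on the right is
        then moved to the left.\<close>
      have "norm (y - b) \<le> K * norm (C (y - b))"
        using K(2)[of "C (y - b)"] B(2) by simp
      also have "\<dots> \<le> K * (norm (\<sigma> y - a) + \<eta> * norm (y - b))"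
      proof -
        have "norm (C (y - b)) \<le> norm (\<sigma> y - a) + norm (\<sigma> y - a - C (y - b))"
          by (metis norm_triangle_sub norm_minus_commute add.commute)
        then show ?thesis
          using e1 K(1) by (intro mult_left_mono) auto
      qed
      also have "\<dots> \<le> K * norm (\<sigma> y - a) + (1 / 2) * norm (y - b)"
      proof -
        have "K * \<eta> \<le> 1 / 2"
          using \<eta>(2) K(1) by (simp add: field_simps)
        from mult_right_mono[OF this norm_ge_zero[of "y - b"]] show ?thesis
          by (simp add: algebra_simps)
      qed
      finally have low: "norm (y - b) \<le> 2 * K * norm (\<sigma> y - a)"
        by simp
      \<comment> \<open>As \<open>C w = w0\<close>, the new distance splits into the linearization
        error and the image under \<open>C\<close> of the old discrepancy
        \<open>y - b - w\<close>.\<close>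
      have "norm (\<sigma> y - a - w0) = norm ((\<sigma> y - a - C (y - b)) + C (y - b - w))"
        using B(3)[of w0] w0 by (simp add: linear_diff[OF linC])
      also have "\<dots> \<le> \<eta> * norm (y - b) + K * (\<theta>' * norm (y - b))"
      proof -
        have "norm (C (y - b - w)) \<le> K * (\<theta>' * norm (y - b))"
          using K(3)[of "y - b - w"] mult_left_mono[OF yw, of K] K(1) by linarith
        then show ?thesis
          using e1 by (intro order_trans[OF norm_triangle_ineq add_mono])
      qed
      also have "\<dots> = (\<eta> + \<theta> / (4 * K)) * norm (y - b)"
        using K(1) by (simp add: \<theta>'_def field_simps)
      also have "\<dots> \<le> (\<theta> / (2 * K)) * norm (y - b)"
        using \<eta>(3) K(1) by (intro mult_right_mono) (auto simp: field_simps)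
      \<comment> \<open>The condition for \<open>h\<close> is relative to
        \<open>norm (\<sigma> y - a)\<close>, so the lower bound is needed here.\<close>
      also have "\<dots> \<le> (\<theta> / (2 * K)) * (2 * K * norm (\<sigma> y - a))"
        using low \<theta> K(1) by (intro mult_left_mono) auto
      also have "\<dots> = \<theta> * norm (\<sigma> y - a)"
        using K(1) by simp
      finally have close: "norm (\<sigma> y - a - w0) \<le> \<theta> * norm (\<sigma> y - a)" .
      have "norm (\<sigma> y - a) \<le> \<delta>"
        using up sm(1) K(1) by (simp add: field_simps)
      from old[OF x(1) w0(1) this close]
      have "norm (h' y - h' b - \<Lambda>' w) \<le> \<epsilon> / (2 * K) * norm (\<sigma> y - a)"
        using x hb w0 \<Lambda> by simp
      also have "\<dots> \<le> \<epsilon> / (2 * K) * (2 * K * norm (y - b))"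
        using up that K(1) \<epsilon> by (intro mult_left_mono) auto
      also have "\<dots> = \<epsilon> * norm (y - b)"
        using K(1) by simp
      finally show ?thesis .
    qed
    with pos show ?thesis
      by blast
  qed
  have "linear_map_on (B ` W) \<Lambda>'"
    unfolding linear_map_on_def
  proof (intro conjI ballI allI)
    fix v w assume "v \<in> B ` W" "w \<in> B ` W"
    then obtain v0 w0 where "v0 \<in> W" "w0 \<in> W" "v = B v0" "w = B w0"
      by blast
    then show "\<Lambda>' (v + w) = \<Lambda>' v + \<Lambda>' w"
      using lin \<Lambda> subspace_add[OF W] by (simp add: linear_add[OF B(1), symmetric] linear_map_on_def)
  next
    fix c w assume "w \<in> B ` W"
    then obtain w0 where "w0 \<in> W" "w = B w0"
      by blast
    then show "\<Lambda>' (c *\<^sub>R w) = c *\<^sub>R \<Lambda>' w"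
      using lin \<Lambda> subspace_scale[OF W] by (simp add: linear_cmul[OF B(1), symmetric] linear_map_on_def)
  qed
  then show ?thesis
    using b(1) linear_subspace_image[OF B(1) W] est unfolding tangential_derivative_def by blast
qed

section \<open>Charts and tangent vectors\<close>

lemma Ck_on_imp_differentiable:
  assumes "Ck_on k S f" "1 \<le> k" "x \<in> S"
  shows "f differentiable (at x)"
proof -
  have "Cn_on (Suc 0) S f"
    using assms(1,2) by (auto simp: Ck_on_def one_enat_def simp del: Cn_on.simps)
  with assms(3) show ?thesis
    by simp
qed

lemma local_chart_inj_on: "local_chart k M U \<phi> \<Longrightarrow> inj_on \<phi> U"
  by (simp add: local_chart_def)

lemma local_chart_openin: "local_chart k M U \<phi> \<Longrightarrow> openin (mtop M) U"
  by (simp add: local_chart_def)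

lemma atlas_openin:
  "differentiable_manifold k M \<Longrightarrow> (U, \<kappa>) \<in> atlas M \<Longrightarrow> openin (mtop M) U"
  by (auto simp: differentiable_manifold_def)

lemma atlas_inj_on:
  assumes "differentiable_manifold k M" "(U, \<kappa>) \<in> atlas M"
  shows "inj_on \<kappa> U"
proof -
  have "homeomorphic_map (subtopology (mtop M) U) (top_of_set (\<kappa> ` U)) \<kappa>" "openin (mtop M) U"
    using assms by (auto simp: differentiable_manifold_def)
  then show ?thesis
    using homeomorphic_imp_injective_map openin_subset by (fastforce simp: inf_absorb2)
qed

section \<open>Neighbourhoods of a point seen through a chart\<close>

text \<open>Continuity of the inverse chart makes the preimage of \<open>N\<close> open. This
  justifies cancelling charts and their inverses near the image point.\<close>

lemma local_chart_eventually:
  assumes "local_chart k M U \<phi>" "p \<in> U" "openin (mtop M) N" "p \<in> N"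
  shows "\<forall>\<^sub>F y in nhds (\<phi> p). y \<in> \<phi> ` U \<and> inv_into U \<phi> y \<in> N"
proof -
  have "continuous_map (top_of_set (\<phi> ` U)) (mtop M) (inv_into U \<phi>)" and op: "open (\<phi> ` U)"
    using assms(1) by (auto simp: local_chart_def Ck_into_manifold_def)
  with assms(3) have "openin (top_of_set (\<phi> ` U)) {y \<in> \<phi> ` U. inv_into U \<phi> y \<in> N}"
    using openin_continuous_map_preimage by fastforce
  with op have "open {y \<in> \<phi> ` U. inv_into U \<phi> y \<in> N}"
    using openin_open_trans by blast
  moreover have "\<phi> p \<in> {y \<in> \<phi> ` U. inv_into U \<phi> y \<in> N}"
    using assms local_chart_inj_on by fastforce
  ultimately show ?thesis
    by (auto simp: eventually_nhds)
qed

text \<open>For an atlas chart the homeomorphism property is at hand, so openness of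
  \<open>\<kappa>\<close> takes the place of continuity of the inverse.\<close>

lemma atlas_eventually:
  assumes "differentiable_manifold k M" "(U, \<kappa>) \<in> atlas M" "p \<in> U" "openin (mtop M) N" "p \<in> N"
  shows "\<forall>\<^sub>F y in nhds (\<kappa> p). y \<in> \<kappa> ` U \<and> inv_into U \<kappa> y \<in> N"
proof -
  have "homeomorphic_map (subtopology (mtop M) U) (top_of_set (\<kappa> ` U)) \<kappa>" and op: "open (\<kappa> ` U)"
    using assms by (auto simp: differentiable_manifold_def)
  moreover have "openin (subtopology (mtop M) U) (N \<inter> U)"
    using assms(4) by (auto simp: openin_subtopology)
  ultimately have "openin (top_of_set (\<kappa> ` U)) (\<kappa> ` (N \<inter> U))"
    using homeomorphic_imp_open_map open_map_def by blast
  with op have "open (\<kappa> ` (N \<inter> U))"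
    using openin_open_trans by blast
  moreover have "\<kappa> p \<in> \<kappa> ` (N \<inter> U)"
    using assms by auto
  moreover have "y \<in> \<kappa> ` U \<and> inv_into U \<kappa> y \<in> N" if "y \<in> \<kappa> ` (N \<inter> U)" for y
    using that atlas_inj_on[OF assms(1,2)] by auto
  ultimately show ?thesis
    unfolding eventually_nhds by blast
qed

section \<open>Derivatives of transition maps\<close>

text \<open>By the chain rule \<open>C \<circ> A\<close> is the derivative of a map that agrees with
  the identity near \<open>x\<close>, and derivatives are unique.\<close>

lemma has_derivative_local_inverse:
  assumes f: "(f has_derivative A) (at x)" and g: "(g has_derivative C) (at (f x))"
    and inv: "\<forall>\<^sub>F y in nhds x. g (f y) = y"
  shows "C (A v) = v"
proof -
  have "((\<lambda>y. g (f y)) has_derivative (\<lambda>v. C (A v))) (at x)"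
    using has_derivative_compose[OF f g] .
  moreover have "((\<lambda>y. g (f y)) has_derivative (\<lambda>v. v)) (at x)"
  proof (rule has_derivative_transform_eventually[OF has_derivative_ident])
    show "\<forall>\<^sub>F y in at x. y = g (f y)"
      using inv unfolding eventually_nhds_conv_at by (simp only: eq_commute)
    show "x = g (f x)"
      using eventually_nhds_x_imp_x[OF inv] by simp
  qed simp
  ultimately show ?thesis
    using has_derivative_unique by metis
qed

text \<open>The two smoothness conditions in \<open>local_chart\<close> give differentiability of
  the two transition maps. These are inverse to each other near the image points, in both orders,
  hence so are their derivatives.\<close>

lemma transition_derivatives:
  fixes M :: "('a, 'm::finite) manifold"
  assumes M: "differentiable_manifold k M" and U: "local_chart k M U \<phi>" "p \<in> U"
    and V: "(V, \<kappa>) \<in> atlas M" "p \<in> V"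
  shows "\<exists>A C. ((\<phi> \<circ> inv_into V \<kappa>) has_derivative A) (at (\<kappa> p)) \<and>
    ((\<kappa> \<circ> inv_into U \<phi>) has_derivative C) (at (\<phi> p)) \<and>
    (\<forall>v. A (C v) = v) \<and> (\<forall>v. C (A v) = v)"
proof -
  have k: "1 \<le> k"
    using M by (simp add: differentiable_manifold_def)
  have inv: "inv_into U \<phi> (\<phi> p) = p" "inv_into V \<kappa> (\<kappa> p) = p"
    using U V local_chart_inj_on[OF U(1)] atlas_inj_on[OF M V(1)] by auto
  have "Ck_on k (\<kappa> ` (U \<inter> V)) (\<phi> \<circ> inv_into V \<kappa>)"
    using U(1) V(1) by (auto simp: local_chart_def Ck_from_manifold_def)
  then have "(\<phi> \<circ> inv_into V \<kappa>) differentiable (at (\<kappa> p))"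
    using U V by (intro Ck_on_imp_differentiable[OF _ k]) auto
  then obtain A where A: "((\<phi> \<circ> inv_into V \<kappa>) has_derivative A) (at (\<kappa> p))"
    by (auto simp: differentiable_def)
  have "Ck_on k (\<phi> ` U \<inter> inv_into U \<phi> -` V) (\<kappa> \<circ> inv_into U \<phi>)"
    using U(1) V(1) by (auto simp: local_chart_def Ck_into_manifold_def)
  then have "(\<kappa> \<circ> inv_into U \<phi>) differentiable (at (\<phi> p))"
    using U V inv by (intro Ck_on_imp_differentiable[OF _ k]) auto
  then obtain C where C: "((\<kappa> \<circ> inv_into U \<phi>) has_derivative C) (at (\<phi> p))"
    by (auto simp: differentiable_def)
  have "\<forall>\<^sub>F y in nhds (\<phi> p). (\<phi> \<circ> inv_into V \<kappa>) ((\<kappa> \<circ> inv_into U \<phi>) y) = y"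
    using local_chart_eventually[OF U atlas_openin[OF M V(1)] V(2)]
    by eventually_elim (simp add: atlas_inj_on[OF M V(1)] f_inv_into_f)
  then have AC: "A (C v) = v" for v
    using A C inv by (intro has_derivative_local_inverse
        [where f = "\<kappa> \<circ> inv_into U \<phi>" and g = "\<phi> \<circ> inv_into V \<kappa>"]) auto
  have "\<forall>\<^sub>F y in nhds (\<kappa> p). (\<kappa> \<circ> inv_into U \<phi>) ((\<phi> \<circ> inv_into V \<kappa>) y) = y"
    using atlas_eventually[OF M V local_chart_openin[OF U(1)] U(2)]
    by eventually_elim (simp add: local_chart_inj_on[OF U(1)] f_inv_into_f)
  then have CA: "C (A v) = v" for v
    using A C inv by (intro has_derivative_local_inverse
        [where f = "\<phi> \<circ> inv_into V \<kappa>" and g = "\<kappa> \<circ> inv_into U \<phi>"]) auto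
  show ?thesis
    using A C AC CA by blast
qed

section \<open>Differentials on classes of curves\<close>

lemma tangent_class_self: "\<gamma> \<in> curves_at M p \<Longrightarrow> \<gamma> \<in> tangent_class M p \<gamma>"
  by (simp add: tangent_class_def case_prod_unfold)

text \<open>Near \<open>0\<close> each representative satisfies \<open>\<phi> \<circ> \<sigma> =
  (\<phi> \<circ> inv_into V \<kappa>) \<circ> (\<kappa> \<circ> \<sigma>)\<close>, and the velocity
  of \<open>\<kappa> \<circ> \<sigma>\<close> is the same throughout the class. The chain rule then
  gives the value.\<close>

lemma differential_tangent_class:
  fixes M :: "('a, 'm::finite) manifold"
  assumes M: "differentiable_manifold k M" and V: "(V, \<kappa>) \<in> atlas M" "p \<in> V"
    and A: "((\<phi> \<circ> inv_into V \<kappa>) has_derivative A) (at (\<kappa> p))"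
    and \<gamma>: "\<gamma> \<in> curves_at M p"
  shows "differential \<phi> (tangent_class M p \<gamma>) = A (vector_derivative (\<kappa> \<circ> \<gamma>) (at 0))"
proof -
  let ?v = "vector_derivative (\<kappa> \<circ> \<gamma>) (at 0)"
  have der: "((\<phi> \<circ> \<sigma>) has_vector_derivative A ?v) (at 0)" if "\<sigma> \<in> tangent_class M p \<gamma>" for \<sigma>
  proof -
    have \<sigma>: "\<sigma> \<in> curves_at M p" "vector_derivative (\<kappa> \<circ> \<sigma>) (at 0) = ?v"
      using that V by (auto simp: tangent_class_def)
    then have "(\<kappa> \<circ> \<sigma>) differentiable (at 0)" and \<sigma>0: "\<sigma> 0 = p"
      and lim: "limitin (mtop M) \<sigma> p (at 0)"
      using V by (auto simp: curves_at_def)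
    then have "((\<kappa> \<circ> \<sigma>) has_vector_derivative ?v) (at 0)"
      using \<sigma>(2) vector_derivative_works by metis
    moreover have "((\<phi> \<circ> inv_into V \<kappa>) has_derivative A) (at ((\<kappa> \<circ> \<sigma>) 0))"
      using A \<sigma>0 by simp
    ultimately have "(((\<phi> \<circ> inv_into V \<kappa>) \<circ> (\<kappa> \<circ> \<sigma>)) has_vector_derivative A ?v) (at 0)"
      by (rule vector_derivative_diff_chain_within
          [OF _ has_derivative_at_withinI])
    \<comment> \<open>The inverse of \<open>\<kappa>\<close> cancels only on \<open>V\<close>. The
      limit condition on curves covers small \<open>t\<close> other than \<open>0\<close>, and
      \<open>\<sigma> 0 = p\<close> covers \<open>0\<close>.\<close>
    moreover have "\<forall>\<^sub>F t in at 0. \<sigma> t \<in> V"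
      using lim atlas_openin[OF M V(1)] V(2) by (simp add: limitin_def)
    then have "\<forall>\<^sub>F t in nhds 0. \<sigma> t \<in> V"
      using V(2) \<sigma>0 by (simp add: eventually_nhds_conv_at)
    then have "\<forall>\<^sub>F t in nhds 0. ((\<phi> \<circ> inv_into V \<kappa>) \<circ> (\<kappa> \<circ> \<sigma>)) t = (\<phi> \<circ> \<sigma>) t"
      by eventually_elim (simp add: atlas_inj_on[OF M V(1)])
    ultimately show ?thesis
      using has_vector_derivative_cong_ev
        [of UNIV "(\<phi> \<circ> inv_into V \<kappa>) \<circ> (\<kappa> \<circ> \<sigma>)" "\<phi> \<circ> \<sigma>" 0] eventually_nhds_x_imp_x by fastforce
  qed
  show ?thesis
    \<comment> \<open>Uniqueness in the definite description needs a nonempty class, and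
      \<open>\<gamma>\<close> is a member.\<close>
    unfolding differential_def
    using der tangent_class_self[OF \<gamma>] vector_derivative_unique_at by (intro the_equality) blast+
qed

text \<open>The coordinate line through \<open>\<phi> p\<close> with direction
  \<open>w = A v\<close>, where \<open>v\<close> is the velocity of
  \<open>\<kappa> \<circ> \<gamma>\<close>, has velocity \<open>C (A v) = v\<close> when seen
  through \<open>\<kappa>\<close>. It therefore represents the same tangent vector as
  \<open>\<gamma>\<close>.\<close>

lemma differential_into_differential:
  fixes M :: "('a, 'm::finite) manifold"
  assumes M: "differentiable_manifold k M" and U: "local_chart k M U \<phi>" "p \<in> U"
    and \<xi>: "\<xi> \<in> tangent_space M p"
  shows "differential_into M (inv_into U \<phi>) (\<phi> p) (differential \<phi> \<xi>) = \<xi>"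
proof -
  obtain \<gamma> where \<gamma>: "\<gamma> \<in> curves_at M p" "\<xi> = tangent_class M p \<gamma>"
    using \<xi> by (auto simp: tangent_space_def)
  define w where "w = differential \<phi> \<xi>"
  have inv: "inv_into U \<phi> (\<phi> p) = p"
    using U local_chart_inj_on by fastforce
  have "vector_derivative (\<kappa> \<circ> (\<lambda>t. inv_into U \<phi> (\<phi> p + t *\<^sub>R w))) (at 0)
      = vector_derivative (\<kappa> \<circ> \<gamma>) (at 0)" if V: "(V, \<kappa>) \<in> atlas M" "p \<in> V" for V \<kappa>
  proof -
    obtain A C where AC: "((\<phi> \<circ> inv_into V \<kappa>) has_derivative A) (at (\<kappa> p))"
      "((\<kappa> \<circ> inv_into U \<phi>) has_derivative C) (at (\<phi> p))" "\<And>v. A (C v) = v" "\<And>v. C (A v) = v"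
      using transition_derivatives[OF M U V] by blast
    have "w = A (vector_derivative (\<kappa> \<circ> \<gamma>) (at 0))"
      using differential_tangent_class[OF M V AC(1) \<gamma>(1)] \<gamma>(2) by (simp add: w_def)
    then have Cw: "C w = vector_derivative (\<kappa> \<circ> \<gamma>) (at 0)"
      using AC(4) by simp
    have "((\<lambda>t. \<phi> p + t *\<^sub>R w) has_vector_derivative w) (at 0)"
      by (auto intro!: derivative_eq_intros simp: has_vector_derivative_def)
    moreover have "((\<kappa> \<circ> inv_into U \<phi>) has_derivative C) (at ((\<lambda>t. \<phi> p + t *\<^sub>R w) 0))"
      using AC(2) by simp
    ultimately have "(((\<kappa> \<circ> inv_into U \<phi>) \<circ> (\<lambda>t. \<phi> p + t *\<^sub>R w)) has_vector_derivative C w) (at 0)"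
      by (rule vector_derivative_diff_chain_within
          [OF _ has_derivative_at_withinI])
    then show ?thesis
      using Cw by (auto simp: o_def intro: vector_derivative_at)
  qed
  \<comment> \<open>A class depends on its representative only through the velocities in the atlas
    charts at \<open>p\<close>.\<close>
  then have "tangent_class M p (\<lambda>t. inv_into U \<phi> (\<phi> p + t *\<^sub>R w)) = tangent_class M p \<gamma>"
    unfolding tangent_class_def by (auto simp: case_prod_unfold)
  then show ?thesis
    using \<gamma>(2) inv by (simp add: differential_into_def w_def)
qed

section \<open>Independence of the chart\<close>

theorem mainTheorem5:
  fixes M :: "('a, 'm::finite) manifold" and k :: enat and p :: 'a
    and V :: "'a tangent_vector set" and L :: "'a tangent_vector \<Rightarrow> real" and f :: "'a \<Rightarrow> real"
  assumes "differentiable_manifold k M"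
    and "p \<in> topspace (mtop M)"
    and "tangent_subspace M p V"
    and "tangent_functional M p V L"
    and "\<exists>U \<phi>. local_chart k M U \<phi> \<and> p \<in> U \<and>
           tangential_derivative (f \<circ> inv_into U \<phi>) (\<phi> ` U) (\<phi> p) (differential \<phi> ` V)
             (L \<circ> differential_into M (inv_into U \<phi>) (\<phi> p))"
  shows "\<forall>U \<phi>. local_chart k M U \<phi> \<and> p \<in> U \<longrightarrow>
           tangential_derivative (f \<circ> inv_into U \<phi>) (\<phi> ` U) (\<phi> p) (differential \<phi> ` V)
             (L \<circ> differential_into M (inv_into U \<phi>) (\<phi> p))"
proof (intro allI impI, elim conjE)
  fix U' :: "'a set" and \<psi> :: "'a \<Rightarrow> real ^ 'm"
  assume U': "local_chart k M U' \<psi>" "p \<in> U'"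
  note M = assms(1)
  obtain U \<phi> where U: "local_chart k M U \<phi>" "p \<in> U" and
    td: "tangential_derivative (f \<circ> inv_into U \<phi>) (\<phi> ` U) (\<phi> p) (differential \<phi> ` V)
       (L \<circ> differential_into M (inv_into U \<phi>) (\<phi> p))"
    using assms(5) by blast
  have "p \<in> (\<Union>(N, \<kappa>)\<in>atlas M. N)"
    using M assms(2) by (simp add: differentiable_manifold_def)
  then obtain N \<kappa> where N: "(N, \<kappa>) \<in> atlas M" "p \<in> N"
    by auto
  obtain A C where AC: "((\<phi> \<circ> inv_into N \<kappa>) has_derivative A) (at (\<kappa> p))"
    "((\<kappa> \<circ> inv_into U \<phi>) has_derivative C) (at (\<phi> p))" "\<And>v. A (C v) = v" "\<And>v. C (A v) = v"
    using transition_derivatives[OF M U N] by blast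
  obtain A' C' where AC': "((\<psi> \<circ> inv_into N \<kappa>) has_derivative A') (at (\<kappa> p))"
    "((\<kappa> \<circ> inv_into U' \<psi>) has_derivative C') (at (\<psi> p))" "\<And>v. A' (C' v) = v" "\<And>v. C' (A' v) = v"
    using transition_derivatives[OF M U' N] by blast
  have inv: "inv_into U' \<psi> (\<psi> p) = p" "inv_into N \<kappa> (\<kappa> p) = p"
    using U' N local_chart_inj_on[OF U'(1)] atlas_inj_on[OF M N(1)] by auto
  \<comment> \<open>Smoothness of \<open>\<phi>\<close> and \<open>\<psi>\<close> is expressed
    through atlas charts, so the transition from \<open>\<psi>\<close> to \<open>\<phi>\<close> is
    factored through \<open>\<kappa>\<close>. Its derivative is \<open>A \<circ> C'\<close>, with
    inverse \<open>A' \<circ> C\<close>.\<close>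
  let ?\<sigma> = "(\<phi> \<circ> inv_into N \<kappa>) \<circ> (\<kappa> \<circ> inv_into U' \<psi>)"
  define B where "B = A' \<circ> C"
  have VT: "V \<subseteq> tangent_space M p"
    using assms(3) by (simp add: tangent_subspace_def)
  \<comment> \<open>If \<open>v\<close> is the velocity in \<open>\<kappa>\<close>, the two
    differentials are \<open>A v\<close> and \<open>A' v\<close>, and
    \<open>C (A v) = v\<close>.\<close>
  have diff: "differential \<psi> \<xi> = B (differential \<phi> \<xi>)" if \<xi>: "\<xi> \<in> V" for \<xi>
  proof -
    obtain \<gamma> where "\<gamma> \<in> curves_at M p" "\<xi> = tangent_class M p \<gamma>"
      using \<xi> VT by (auto simp: tangent_space_def)
    then show ?thesis
      using differential_tangent_class[OF M N AC(1)] differential_tangent_class[OF M N AC'(1)] AC(4)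
      by (simp add: B_def)
  qed
  have "tangential_derivative (f \<circ> inv_into U' \<psi>) (\<psi> ` U') (\<psi> p) (B ` differential \<phi> ` V)
      (L \<circ> differential_into M (inv_into U' \<psi>) (\<psi> p))"
  proof (rule tangential_derivative_change_of_coordinates[OF td])
    show "\<psi> p \<in> \<psi> ` U'" "?\<sigma> (\<psi> p) = \<phi> p"
      using U' inv by auto
    show "(?\<sigma> has_derivative (A \<circ> C')) (at (\<psi> p))"
      using AC(1) AC'(2) inv by (intro diff_chain_at) auto
    show "linear B"
      unfolding B_def using AC(2) AC'(1) has_derivative_linear linear_compose by blast
    show "B ((A \<circ> C') y) = y" for y
      by (simp add: B_def AC AC')
    show "(A \<circ> C') (B x) = x" for x
      by (simp add: B_def AC AC')
    \<comment> \<open>Close to \<open>\<psi> p\<close> the point \<open>inv_into U' \<psi> y\<close>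
      lies in both \<open>N\<close> and \<open>U\<close>: the first lets \<open>\<kappa>\<close>
      cancel, the second lets \<open>\<phi>\<close> cancel.\<close>
    show "\<forall>\<^sub>F y in nhds (\<psi> p). y \<in> \<psi> ` U' \<longrightarrow>
        ?\<sigma> y \<in> \<phi> ` U \<and> (f \<circ> inv_into U' \<psi>) y = (f \<circ> inv_into U \<phi>) (?\<sigma> y)"
      using local_chart_eventually[OF U' local_chart_openin[OF U(1)] U(2)]
        local_chart_eventually[OF U' atlas_openin[OF M N(1)] N(2)]
      by eventually_elim (simp add: atlas_inj_on[OF M N(1)] local_chart_inj_on[OF U(1)])
    \<comment> \<open>Both sides are \<open>L \<xi>\<close>, because each
      \<open>differential_into\<close> recovers \<open>\<xi>\<close> from its coordinate
      vector.\<close>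
    show "(L \<circ> differential_into M (inv_into U' \<psi>) (\<psi> p)) (B w)
        = (L \<circ> differential_into M (inv_into U \<phi>) (\<phi> p)) w" if w: "w \<in> differential \<phi> ` V" for w
    proof -
      obtain \<xi> where \<xi>: "\<xi> \<in> V" "w = differential \<phi> \<xi>"
        using w by blast
      then have "differential_into M (inv_into U \<phi>) (\<phi> p) w = \<xi>"
        using differential_into_differential[OF M U] VT by blast
      moreover have "differential_into M (inv_into U' \<psi>) (\<psi> p) (B w) = \<xi>"
        using differential_into_differential[OF M U'] VT \<xi> by (metis diff subsetD)
      ultimately show ?thesis
        by simp
    qed
  qed
  moreover have "B ` differential \<phi> ` V = differential \<psi> ` V"
    using diff by (force simp: image_image)
  ultimately show "tangential_derivative (f \<circ> inv_into U' \<psi>) (\<psi> ` U') (\<psi> p) (differential \<psi> ` V)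
      (L \<circ> differential_into M (inv_into U' \<psi>) (\<psi> p))"
    by simp
qed

end
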